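(* Let $m\ge 1$, $p=4m$, and let $\Lambda=(\lambda_1,\ldots,\lambda_n)\subset\mathbb{R}^p$ be an admissible configuration whose affine span is all of $\mathbb{R}^p$. Then $$Z_{\mathbb H}(\Lambda)=\Big\{q=(q_1,\ldots,q_n)\in\mathbb{H}^n:\ \sum_{i=1}^n\lambda_i|q_i|^2=0,\ \sum_{i=1}^n|q_i|^2=1\Big\}$$ is a compact smooth manifold of dimension $4n-p-1=4n-4m-1$.
   Context: $\mathbb{H}$ denotes the quaternions, and $\mathbb{H}^m$ is identified with $\mathbb{R}^{4m}$ as a real vector space. A configuration $\Lambda=(\lambda_1,\ldots,\lambda_n)$ of vectors in $\mathbb{R}^p$ is admissible if (Siegel condition) $0\in\operatorname{conv}\{\lambda_1,\ldots,\lambda_n\}$ and (weak hyperbolicity) for every $I\subset\{1,\ldots,n\}$, $0\in\operatorname{conv}\{\lambda_i:i\in I\}$ implies $|I|>p$. The manifold structure on $Z_{\mathbb H}(\Lambda)$ is that of a submanifold of $\mathbb{H}^n\simeq\mathbb{R}^{4n}$. *)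

theory Defs
  imports "HOL-Analysis.Analysis"
begin

section \<open>Quaternions\<close>

text \<open>
  The quaternions as a normed division algebra over the reals which is at the same time a
  four-dimensional Euclidean space with orthonormal basis 1, i, j, k and
  the quaternion modulus as norm.
\<close>

codatatype quat = Quat (Re_q: real) (Im_i: real) (Im_j: real) (Im_k: real)

lemma quat_eq_iff:
  "x = y \<longleftrightarrow> Re_q x = Re_q y \<and> Im_i x = Im_i y \<and> Im_j x = Im_j y \<and> Im_k x = Im_k y"
  by (auto intro: quat.expand)

instantiation quat :: real_vector
begin

primcorec zero_quat where
  "Re_q 0 = 0" | "Im_i 0 = 0" | "Im_j 0 = 0" | "Im_k 0 = 0"

primcorec plus_quat where
  "Re_q (x + y) = Re_q x + Re_q y"
| "Im_i (x + y) = Im_i x + Im_i y"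
| "Im_j (x + y) = Im_j x + Im_j y"
| "Im_k (x + y) = Im_k x + Im_k y"

primcorec uminus_quat where
  "Re_q (- x) = - Re_q x"
| "Im_i (- x) = - Im_i x"
| "Im_j (- x) = - Im_j x"
| "Im_k (- x) = - Im_k x"

primcorec minus_quat where
  "Re_q (x - y) = Re_q x - Re_q y"
| "Im_i (x - y) = Im_i x - Im_i y"
| "Im_j (x - y) = Im_j x - Im_j y"
| "Im_k (x - y) = Im_k x - Im_k y"

primcorec scaleR_quat where
  "Re_q (r *\<^sub>R x) = r * Re_q x"
| "Im_i (r *\<^sub>R x) = r * Im_i x"
| "Im_j (r *\<^sub>R x) = r * Im_j x"
| "Im_k (r *\<^sub>R x) = r * Im_k x"

instance
  by standard (simp_all add: quat_eq_iff algebra_simps)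

end

instantiation quat :: real_algebra_1
begin

primcorec one_quat where
  "Re_q 1 = 1" | "Im_i 1 = 0" | "Im_j 1 = 0" | "Im_k 1 = 0"

primcorec times_quat where
  "Re_q (x * y) = Re_q x * Re_q y - Im_i x * Im_i y - Im_j x * Im_j y - Im_k x * Im_k y"
| "Im_i (x * y) = Re_q x * Im_i y + Im_i x * Re_q y + Im_j x * Im_k y - Im_k x * Im_j y"
| "Im_j (x * y) = Re_q x * Im_j y - Im_i x * Im_k y + Im_j x * Re_q y + Im_k x * Im_i y"
| "Im_k (x * y) = Re_q x * Im_k y + Im_i x * Im_j y - Im_j x * Im_i y + Im_k x * Re_q y"

instance
  by standard (simp_all add: quat_eq_iff algebra_simps)

end

instantiation quat :: real_inner
begin

definition inner_quat :: "quat \<Rightarrow> quat \<Rightarrow> real" where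
  "inner_quat x y = Re_q x * Re_q y + Im_i x * Im_i y + Im_j x * Im_j y + Im_k x * Im_k y"

definition norm_quat :: "quat \<Rightarrow> real" where
  "norm_quat x = sqrt ((Re_q x)\<^sup>2 + (Im_i x)\<^sup>2 + (Im_j x)\<^sup>2 + (Im_k x)\<^sup>2)"

definition sgn_quat :: "quat \<Rightarrow> quat" where
  "sgn_quat x = x /\<^sub>R norm x"

definition dist_quat :: "quat \<Rightarrow> quat \<Rightarrow> real" where
  "dist_quat x y = norm (x - y)"

definition uniformity_quat :: "(quat \<times> quat) filter" where
  "uniformity_quat = (INF e\<in>{0<..}. principal {(x, y). dist x y < e})"

definition open_quat :: "quat set \<Rightarrow> bool" where
  "open_quat U \<longleftrightarrow> (\<forall>x\<in>U. eventually (\<lambda>(x', y). x' = x \<longrightarrow> y \<in> U) uniformity)"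

instance
proof
  fix x y z :: quat and r :: real and U :: "quat set"
  show "dist x y = norm (x - y)" by (rule dist_quat_def)
  show "sgn x = x /\<^sub>R norm x" by (rule sgn_quat_def)
  show "uniformity = (INF e\<in>{0<..}. principal {(x::quat, y). dist x y < e})"
    by (rule uniformity_quat_def)
  show "open U \<longleftrightarrow> (\<forall>x\<in>U. \<forall>\<^sub>F (x', y) in uniformity. x' = x \<longrightarrow> y \<in> U)"
    by (rule open_quat_def)
  show "inner x y = inner y x"
    by (simp add: inner_quat_def mult.commute)
  show "inner (x + y) z = inner x z + inner y z"
    by (simp add: inner_quat_def algebra_simps)
  show "inner (r *\<^sub>R x) y = r * inner x y"
    by (simp add: inner_quat_def algebra_simps)
  show "0 \<le> inner x x"
    by (simp add: inner_quat_def)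
  show "inner x x = 0 \<longleftrightarrow> x = 0"
    by (simp add: inner_quat_def quat_eq_iff add_nonneg_eq_0_iff)
  show "norm x = sqrt (inner x x)"
    by (simp add: inner_quat_def norm_quat_def power2_eq_square)
qed

end

instantiation quat :: real_normed_div_algebra
begin

primcorec inverse_quat where
  "Re_q (inverse x) = Re_q x / (norm x)\<^sup>2"
| "Im_i (inverse x) = - Im_i x / (norm x)\<^sup>2"
| "Im_j (inverse x) = - Im_j x / (norm x)\<^sup>2"
| "Im_k (inverse x) = - Im_k x / (norm x)\<^sup>2"

definition divide_quat :: "quat \<Rightarrow> quat \<Rightarrow> quat" where
  "divide_quat x y = x * inverse y"

instance
proof
  fix x y :: quat
  have sq: "(norm z)\<^sup>2 = (Re_q z)\<^sup>2 + (Im_i z)\<^sup>2 + (Im_j z)\<^sup>2 + (Im_k z)\<^sup>2" for z :: quat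
    by (simp add: norm_quat_def)
  show "x div y = x * inverse y" by (rule divide_quat_def)
  show "inverse (0::quat) = 0" by (simp add: quat_eq_iff)
  show "norm (x * y) = norm x * norm y"
  proof (rule power2_eq_imp_eq)
    show "(norm (x * y))\<^sup>2 = (norm x * norm y)\<^sup>2"
      unfolding power_mult_distrib sq times_quat.simps by algebra
  qed simp_all
  {
    assume "x \<noteq> 0"
    then have nz: "(norm x)\<^sup>2 \<noteq> 0" by simp
    let ?c = "Quat (Re_q x) (- Im_i x) (- Im_j x) (- Im_k x)"
    have inv: "inverse x = ?c /\<^sub>R (norm x)\<^sup>2"
      by (simp add: quat_eq_iff divide_inverse mult.commute)
    have cnj: "?c * x = (norm x)\<^sup>2 *\<^sub>R 1" "x * ?c = (norm x)\<^sup>2 *\<^sub>R 1"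
      by (simp_all only: sq) (simp_all add: quat_eq_iff power2_eq_square)
    show "inverse x * x = 1"
      unfolding inv mult_scaleR_left cnj using nz by simp
    show "x * inverse x = 1"
      unfolding inv mult_scaleR_right cnj using nz by simp
  }
qed

end

instantiation quat :: euclidean_space
begin

definition Basis_quat :: "quat set" where
  "Basis_quat = {Quat 1 0 0 0, Quat 0 1 0 0, Quat 0 0 1 0, Quat 0 0 0 1}"

instance
proof
  fix u v x :: quat
  show "(Basis :: quat set) \<noteq> {}" and "finite (Basis :: quat set)"
    by (simp_all add: Basis_quat_def)
  show "inner u v = (if u = v then 1 else 0)" if "u \<in> Basis" "v \<in> Basis"
    using that unfolding Basis_quat_def by (elim insertE emptyE) (simp_all add: inner_quat_def)
  show "(\<forall>u\<in>Basis. inner x u = 0) \<longleftrightarrow> x = 0"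
    by (simp add: Basis_quat_def inner_quat_def quat_eq_iff [of x 0])
qed

end

lemma DIM_quat [simp]: "DIM(quat) = 4"
  by (simp add: Basis_quat_def)


section \<open>Smooth maps and smooth submanifolds of Euclidean spaces\<close>

text \<open>
  A map is k times continuously differentiable on an open set if it is differentiable there and
  all its directional derivatives are k - 1 times continuously differentiable; in finite
  dimension this agrees with continuity of the iterated Frechet derivatives up to order k.
\<close>

primrec cont_diff_on ::
  "nat \<Rightarrow> ('a::euclidean_space \<Rightarrow> 'b::euclidean_space) \<Rightarrow> 'a set \<Rightarrow> bool" where
  "cont_diff_on 0 f S \<longleftrightarrow> continuous_on S f"
| "cont_diff_on (Suc k) f S \<longleftrightarrow>
     (\<forall>x\<in>S. f differentiable (at x)) \<and>
     (\<forall>v. cont_diff_on k (\<lambda>x. frechet_derivative f (at x) v) S)"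

definition smooth_on :: "('a::euclidean_space \<Rightarrow> 'b::euclidean_space) \<Rightarrow> 'a set \<Rightarrow> bool" where
  "smooth_on f S \<longleftrightarrow> open S \<and> (\<forall>k. cont_diff_on k f S)"

definition diffeomorphism ::
  "'a::euclidean_space set \<Rightarrow> 'b::euclidean_space set \<Rightarrow> ('a \<Rightarrow> 'b) \<Rightarrow> ('b \<Rightarrow> 'a) \<Rightarrow> bool" where
  "diffeomorphism U V f g \<longleftrightarrow> homeomorphism U V f g \<and> smooth_on f U \<and> smooth_on g V"

text \<open>
  Embedded smooth submanifolds (without boundary) of pure dimension d, by slice charts: near each
  of its points, M is flattened onto an open piece of a d-dimensional linear subspace by a
  diffeomorphism between open subsets of the ambient space.
\<close>

definition smooth_submanifold :: "nat \<Rightarrow> 'a::euclidean_space set \<Rightarrow> bool" where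
  "smooth_submanifold d M \<longleftrightarrow>
     (\<forall>x\<in>M. \<exists>U V f g L. x \<in> U \<and> diffeomorphism U V f g \<and>
        subspace (L :: 'a set) \<and> dim L = d \<and> f ` (U \<inter> M) = V \<inter> L)"


section \<open>Admissible configurations\<close>

text \<open>
  A configuration is an indexed family, so repeated vectors are allowed: in weak hyperbolicity
  the set of indices is counted, not the set of vectors.
\<close>

definition siegel :: "('n::finite \<Rightarrow> 'a::euclidean_space) \<Rightarrow> bool" where
  "siegel lam \<longleftrightarrow> 0 \<in> convex hull (range lam)"

definition weakly_hyperbolic :: "('n::finite \<Rightarrow> 'a::euclidean_space) \<Rightarrow> bool" where
  "weakly_hyperbolic lam \<longleftrightarrow> (\<forall>I. 0 \<in> convex hull (lam ` I) \<longrightarrow> DIM('a) < card I)"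

definition admissible :: "('n::finite \<Rightarrow> 'a::euclidean_space) \<Rightarrow> bool" where
  "admissible lam \<longleftrightarrow> siegel lam \<and> weakly_hyperbolic lam"

lemma admissible_DIM_less_CARD:
  fixes lam :: "'n::finite \<Rightarrow> 'a::euclidean_space"
  assumes "admissible lam"
  shows "DIM('a) < CARD('n)"
  using assms unfolding admissible_def siegel_def weakly_hyperbolic_def by blast

definition Z_quat :: "('n::finite \<Rightarrow> 'a::euclidean_space) \<Rightarrow> (quat ^ 'n) set" where
  "Z_quat lam = {q. (\<Sum>i\<in>UNIV. (norm (q $ i))\<^sup>2 *\<^sub>R lam i) = 0 \<and>
                    (\<Sum>i\<in>UNIV. (norm (q $ i))\<^sup>2) = 1}"

end

theory Submission
  imports Defs
begin

text \<open>
  At a point \<open>x\<close> of the intersection of quadrics, 0 is a convex combination of the \<open>\<lambda>\<^sub>i\<close> with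
  \<open>x\<^sub>i \<noteq> 0\<close>. By Caratheodory's theorem and weak hyperbolicity these vectors affinely span the whole
  space, so some \<open>p + 1\<close> of the homogenized vectors \<open>(\<lambda>\<^sub>j, 1)\<close> form a basis. In the dual basis the
  equations become \<open>\<bar>q\<^sub>j\<bar>\<^sup>2 + (terms in the q\<^sub>i with i outside the basis) = const\<close>, one for each
  basis index \<open>j\<close>. Each of them can be solved by a square root for one real coordinate of \<open>q\<^sub>j\<close> that
  does not vanish at \<open>x\<close>, which makes the slice charts explicit and avoids the implicit function
  theorem.
\<close>

section \<open>Calculus of smooth maps\<close>

text \<open>The Frechet derivative at a point depends only on the values near it, so openness of
  \<open>S\<close> lets the equality pass to derivatives of every order.\<close>

lemma cont_diff_on_cong:
  assumes "open S" and "\<And>x. x \<in> S \<Longrightarrow> f x = g x" and "cont_diff_on k f S"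
  shows "cont_diff_on k g S"
  using assms(2,3)
proof (induction k arbitrary: f g)
  case 0
  then show ?case by (auto elim: continuous_on_eq)
next
  case (Suc k)
  have f: "(f has_derivative frechet_derivative f (at x)) (at x)" if "x \<in> S" for x
    using Suc.prems(2) that by (simp add: frechet_derivative_works)
  have g: "(g has_derivative frechet_derivative f (at x)) (at x)" if "x \<in> S" for x
    using Suc.prems(1) by (rule has_derivative_transform_within_open[OF f[OF that] assms(1) that])
  have eq: "frechet_derivative f (at x) = frechet_derivative g (at x)" if "x \<in> S" for x
    using g[OF that] by (rule frechet_derivative_at)
  have "cont_diff_on k (\<lambda>x. frechet_derivative g (at x) v) S" for v
    by (rule Suc.IH[of "\<lambda>x. frechet_derivative f (at x) v"]) (use eq Suc.prems(2) in auto)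
  then show ?case
    using g by (auto simp: differentiable_def)
qed

text \<open>Lets any explicit derivative \<open>f'\<close> stand in for the chosen
  \<open>frechet_derivative\<close>, since derivatives are unique.\<close>

lemma cont_diff_on_Suc:
  assumes "open S" and "\<And>x. x \<in> S \<Longrightarrow> (f has_derivative f' x) (at x)"
    and "\<And>v. cont_diff_on k (\<lambda>x. f' x v) S"
  shows "cont_diff_on (Suc k) f S"
proof -
  have "f' x = frechet_derivative f (at x)" if "x \<in> S" for x
    using assms(2)[OF that] by (rule frechet_derivative_at)
  then have "cont_diff_on k (\<lambda>x. frechet_derivative f (at x) v) S" for v
    using cont_diff_on_cong[OF assms(1) _ assms(3)[of v]] by simp
  then show ?thesis
    using assms(2) by (auto simp: differentiable_def)
qed

text \<open>Product and chain rules leave undifferentiated factors in the derivative, which must be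
  regarded as maps of one order less.\<close>

lemma cont_diff_on_SucD:
  assumes "cont_diff_on (Suc k) f S"
  shows "cont_diff_on k f S"
  using assms
proof (induction k arbitrary: f)
  case 0
  then show ?case
    by (auto intro!: continuous_at_imp_continuous_on differentiable_imp_continuous_within)
qed auto

lemma has_derivative_frechet_derivative:
  assumes "cont_diff_on (Suc k) f S" and "x \<in> S"
  shows "(f has_derivative frechet_derivative f (at x)) (at x)"
  using assms by (simp add: frechet_derivative_works)

lemma smooth_on_imp_continuous_on: "smooth_on f S \<Longrightarrow> continuous_on S f"
  by (metis cont_diff_on.simps(1) smooth_on_def)

lemma smooth_on_subset:
  assumes "smooth_on f T" and "S \<subseteq> T" and "open S"
  shows "smooth_on f S"
proof -
  have "cont_diff_on k f S" if "cont_diff_on k f T" for k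
    using that
    by (induction k arbitrary: f) (use assms(2) in \<open>auto intro: continuous_on_subset\<close>)
  then show ?thesis using assms by (auto simp: smooth_on_def)
qed

lemma smooth_on_const:
  assumes "open S"
  shows "smooth_on (\<lambda>_. c) S"
proof -
  have "cont_diff_on k (\<lambda>_. c) S" for k
    by (induction k arbitrary: c) (auto intro: cont_diff_on_Suc[OF assms has_derivative_const])
  then show ?thesis using assms by (simp add: smooth_on_def)
qed

lemma smooth_on_linear:
  assumes "bounded_linear f" and "open S"
  shows "smooth_on f S"
proof -
  have "cont_diff_on k f S" for k
  proof (cases k)
    case 0
    then show ?thesis
      using linear_continuous_on[OF assms(1)] by simp
  next
    case (Suc l)
    have "cont_diff_on l (\<lambda>_. f v) S" for v
      using smooth_on_const[OF assms(2)] by (auto simp: smooth_on_def)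
    then show ?thesis
      unfolding Suc by (rule cont_diff_on_Suc[OF assms(2) bounded_linear_imp_has_derivative[OF assms(1)]])
  qed
  then show ?thesis using assms by (simp add: smooth_on_def)
qed

section \<open>Sums, bilinear products and real powers\<close>

lemma cont_diff_on_add:
  assumes "open S" and "cont_diff_on k f S" and "cont_diff_on k g S"
  shows "cont_diff_on k (\<lambda>x. f x + g x) S"
  using assms(2,3)
proof (induction k arbitrary: f g)
  case 0
  then show ?case by (auto intro: continuous_intros)
next
  case (Suc k)
  have D: "cont_diff_on k (\<lambda>x. frechet_derivative f (at x) v + frechet_derivative g (at x) v) S" for v
    using Suc by auto
  show ?case
    by (rule cont_diff_on_Suc[OF assms(1) has_derivative_add D])
      (use Suc.prems in \<open>auto intro: has_derivative_frechet_derivative\<close>)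
qed

text \<open>The product rule gives two terms to which induction applies at order \<open>k\<close>;
  one lemma serves multiplication, scaling and inner products.\<close>

lemma cont_diff_on_bilinear:
  assumes "bounded_bilinear p" and "open S" and "cont_diff_on k f S" and "cont_diff_on k g S"
  shows "cont_diff_on k (\<lambda>x. p (f x) (g x)) S"
  using assms(3,4)
proof (induction k arbitrary: f g)
  case 0
  then show ?case
    using bounded_bilinear.continuous_on[OF assms(1)] by auto
next
  case (Suc k)
  have "cont_diff_on k f S" "cont_diff_on k g S"
    using Suc.prems by (auto intro: cont_diff_on_SucD)
  then have D: "cont_diff_on k (\<lambda>x. p (f x) (frechet_derivative g (at x) v) +
      p (frechet_derivative f (at x) v) (g x)) S" for v
    using Suc by (intro cont_diff_on_add[OF assms(2)]) auto
  show ?case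
    by (rule cont_diff_on_Suc[OF assms(2) bounded_bilinear.FDERIV[OF assms(1)] D])
      (use Suc.prems in \<open>auto intro: has_derivative_frechet_derivative\<close>)
qed

text \<open>The exponent stays arbitrary in the induction because differentiation lowers it by 1;
  the value 1/2 later gives square roots.\<close>

lemma cont_diff_on_powr:
  fixes f :: "'a::euclidean_space \<Rightarrow> real"
  assumes "open S" and "\<And>x. x \<in> S \<Longrightarrow> 0 < f x" and "cont_diff_on k f S"
  shows "cont_diff_on k (\<lambda>x. f x powr a) S"
  using assms(3)
proof (induction k arbitrary: a)
  case 0
  then show ?case using assms(2) by (force intro!: continuous_intros)
next
  case (Suc k)
  have k: "cont_diff_on k (\<lambda>x. f x powr (a - 1)) S"
    using Suc.IH cont_diff_on_SucD[OF Suc.prems] .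
  have const: "cont_diff_on k (\<lambda>_. a) S"
    using smooth_on_const[OF assms(1), of a] by (simp add: smooth_on_def)
  have D: "cont_diff_on k (\<lambda>x. (a * f x powr (a - 1)) * frechet_derivative f (at x) v) S" for v
    using Suc.prems const k
    by (intro cont_diff_on_bilinear[OF bounded_bilinear_mult assms(1)]) auto
  have "((\<lambda>x. f x powr a) has_derivative
      (\<lambda>v. (a * f x powr (a - 1)) * frechet_derivative f (at x) v)) (at x)" if "x \<in> S" for x
  proof -
    have "((\<lambda>u. u powr a) has_derivative (\<lambda>v. (a * f x powr (a - 1)) * v)) (at (f x))"
      using has_real_derivative_powr[OF assms(2)[OF that]]
      by (simp add: has_field_derivative_def)
    from has_derivative_compose[OF has_derivative_frechet_derivative[OF Suc.prems that] this]
    show ?thesis .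
  qed
  then show ?case by (rule cont_diff_on_Suc[OF assms(1) _ D])
qed

section \<open>Closure rules for smooth maps\<close>

lemma smooth_on_add: "smooth_on f S \<Longrightarrow> smooth_on g S \<Longrightarrow> smooth_on (\<lambda>x. f x + g x) S"
  by (simp add: smooth_on_def cont_diff_on_add)

lemma smooth_on_bilinear:
  "bounded_bilinear p \<Longrightarrow> smooth_on f S \<Longrightarrow> smooth_on g S \<Longrightarrow> smooth_on (\<lambda>x. p (f x) (g x)) S"
  by (simp add: smooth_on_def cont_diff_on_bilinear)

lemmas smooth_on_mult = smooth_on_bilinear[OF bounded_bilinear_mult]
lemmas smooth_on_scaleR = smooth_on_bilinear[OF bounded_bilinear_scaleR]
lemmas smooth_on_inner = smooth_on_bilinear[OF bounded_bilinear_inner]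

lemma smooth_on_diff:
  assumes "smooth_on f S" and "smooth_on g S"
  shows "smooth_on (\<lambda>x. f x - g x) S"
proof -
  have "smooth_on (\<lambda>x. (- 1) *\<^sub>R g x) S"
    using assms by (intro smooth_on_scaleR smooth_on_const) (auto simp: smooth_on_def)
  from smooth_on_add[OF assms(1) this] show ?thesis by simp
qed

lemma smooth_on_sum:
  assumes "open S" and "\<And>i. i \<in> I \<Longrightarrow> smooth_on (f i) S"
  shows "smooth_on (\<lambda>x. \<Sum>i\<in>I. f i x) S"
  using assms(2)
  by (induction I rule: infinite_finite_induct)
    (simp_all add: smooth_on_const[OF assms(1)] smooth_on_add)

lemma smooth_on_sqrt:
  fixes f :: "'a::euclidean_space \<Rightarrow> real"
  assumes "smooth_on f S" and "\<And>x. x \<in> S \<Longrightarrow> 0 < f x"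
  shows "smooth_on (\<lambda>x. sqrt (f x)) S"
proof -
  have "open S" using assms by (simp add: smooth_on_def)
  then have "cont_diff_on k (\<lambda>x. f x powr (1/2)) S" for k
    using assms by (simp add: smooth_on_def cont_diff_on_powr)
  then have "cont_diff_on k (\<lambda>x. sqrt (f x)) S" for k
    by (rule cont_diff_on_cong[OF \<open>open S\<close>, rotated])
      (simp add: powr_half_sqrt assms(2) less_imp_le)
  then show ?thesis using \<open>open S\<close> by (simp add: smooth_on_def)
qed

lemma smooth_on_power2:
  fixes f :: "'a::euclidean_space \<Rightarrow> real"
  shows "smooth_on f S \<Longrightarrow> smooth_on (\<lambda>x. (f x)\<^sup>2) S"
  by (simp add: power2_eq_square smooth_on_mult)


section \<open>Slice charts\<close>

text \<open>The chart exchanges each coordinate along \<open>e j\<close> for the value of the \<open>j\<close>-th equation;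
  it is inverted by a square root whose sign is that of the coordinate at \<open>x\<close>.\<close>

lemma quadratic_slice_chart:
  fixes e :: "'i \<Rightarrow> 'a::euclidean_space" and R :: "'i \<Rightarrow> 'a \<Rightarrow> real"
  assumes "finite J" and inj: "inj_on e J" and Basis: "e ` J \<subseteq> Basis"
    and smooth: "\<And>j. j \<in> J \<Longrightarrow> smooth_on (R j) UNIV"
    and indep: "\<And>j y z. j \<in> J \<Longrightarrow> (\<And>b. b \<in> Basis - e ` J \<Longrightarrow> y \<bullet> b = z \<bullet> b) \<Longrightarrow> R j y = R j z"
    and M: "M = {q. \<forall>j\<in>J. (q \<bullet> e j)\<^sup>2 + R j q = 0}"
    and nz: "\<And>j. j \<in> J \<Longrightarrow> x \<bullet> e j \<noteq> 0"
  shows "\<exists>U V f g L. x \<in> U \<and> diffeomorphism U V f g \<and>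
    subspace (L :: 'a set) \<and> dim L = DIM('a) - card J \<and> f ` (U \<inter> M) = V \<inter> L"
proof -
  define s where "s j = sgn (x \<bullet> e j)" for j
  \<comment> \<open>\<open>upd c y\<close> overwrites the coordinates along \<open>e j\<close> by
    \<open>c j\<close> and keeps the rest, so \<open>f\<close> and \<open>g\<close> are two
    instances of one operation.\<close>
  define upd where "upd c y = y + (\<Sum>j\<in>J. (c j - y \<bullet> e j) *\<^sub>R e j)" for c y
  \<comment> \<open>Fixed signs make squaring the selected coordinates injective on
    \<open>U\<close>; on \<open>V\<close> the radicands in \<open>g\<close> are positive.\<close>
  define U where "U = {q. \<forall>j\<in>J. 0 < s j * (q \<bullet> e j)}"
  define V where "V = {y. \<forall>j\<in>J. 0 < y \<bullet> e j - R j y}"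
  define f where "f q = upd (\<lambda>j. (q \<bullet> e j)\<^sup>2 + R j q) q" for q
  define g where "g y = upd (\<lambda>j. s j * sqrt (y \<bullet> e j - R j y)) y" for y
  define L where "L = {y :: 'a. \<forall>j\<in>J. y \<bullet> e j = 0}"

  have ee: "e i \<bullet> e j = (if i = j then 1 else 0)" if "i \<in> J" "j \<in> J" for i j
    using that Basis inj by (auto simp: inner_Basis inj_on_eq_iff image_subset_iff)
  have upd_in: "upd c y \<bullet> e j = c j" if "j \<in> J" for c y j
    using that \<open>finite J\<close>
    by (simp add: upd_def inner_add_left inner_sum_left ee if_distrib cong: if_cong)
  have upd_out: "upd c y \<bullet> b = y \<bullet> b" if "b \<in> Basis - e ` J" for c y b
  proof -
    have "e j \<bullet> b = 0" if "j \<in> J" for j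
      using that \<open>b \<in> Basis - e ` J\<close> Basis by (subst inner_Basis) auto
    then show ?thesis by (simp add: upd_def inner_add_left inner_sum_left)
  qed
  \<comment> \<open>The overwritten coordinates do not enter any \<open>R j\<close>, so the
    equations decouple and each is solved on its own.\<close>
  have R_upd: "R j (upd c y) = R j y" if "j \<in> J" for j c y
    using that upd_out by (intro indep) auto
  have upd_eqI: "upd c y = z"
    if "\<And>j. j \<in> J \<Longrightarrow> c j = z \<bullet> e j" and "\<And>b. b \<in> Basis - e ` J \<Longrightarrow> y \<bullet> b = z \<bullet> b" for c y z
  proof (rule euclidean_eqI)
    fix b :: 'a assume "b \<in> Basis"
    then show "upd c y \<bullet> b = z \<bullet> b"
      using that upd_in upd_out by (cases "b \<in> e ` J") auto
  qed

  have s2: "s j * s j = 1" if "j \<in> J" for j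
    using nz[OF that] by (simp add: s_def sgn_if)
  have f_V: "f q \<in> V" if "q \<in> U" for q
    using that by (auto simp: V_def U_def f_def upd_in R_upd)
  have g_U: "g y \<in> U" if "y \<in> V" for y
    using that by (auto simp: V_def U_def g_def upd_in R_upd s2 simp flip: mult.assoc)
  have gf: "g (f q) = q" if "q \<in> U" for q
    unfolding g_def
  proof (rule upd_eqI)
    fix j assume j: "j \<in> J"
    then have "0 < s j * (q \<bullet> e j)" using that by (simp add: U_def)
    \<comment> \<open>The square root of the squared coordinate is its absolute value; on
      \<open>U\<close> the factor \<open>s j\<close> restores the sign.\<close>
    then have "s j * \<bar>q \<bullet> e j\<bar> = q \<bullet> e j"
      by (auto simp: s_def sgn_if zero_less_mult_iff split: if_splits)
    then show "s j * sqrt (f q \<bullet> e j - R j (f q)) = q \<bullet> e j"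
      using j by (simp add: f_def upd_in R_upd)
  qed (simp add: f_def upd_out)
  have fg: "f (g y) = y" if "y \<in> V" for y
    unfolding f_def
  proof (rule upd_eqI)
    fix j assume j: "j \<in> J"
    then have "0 < y \<bullet> e j - R j y" using that by (simp add: V_def)
    then show "(g y \<bullet> e j)\<^sup>2 + R j (g y) = y \<bullet> e j"
      using j s2[OF j] by (simp add: g_def upd_in R_upd power_mult_distrib power2_eq_square[of "s j"])
  qed (simp add: g_def upd_out)

  \<comment> \<open>Openness of the domains and smoothness of the chart\<close>
  have contR: "continuous_on UNIV (R j)" if "j \<in> J" for j
    using smooth[OF that] by (rule smooth_on_imp_continuous_on)
  have "open U"
  proof -
    have "U = (\<Inter>j\<in>J. {q. 0 < s j * (q \<bullet> e j)})" by (auto simp: U_def)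
    then show ?thesis
      using \<open>finite J\<close> by (auto intro!: open_INT open_Collect_less continuous_intros)
  qed
  have "open V"
  proof -
    have "V = (\<Inter>j\<in>J. {y. 0 < y \<bullet> e j - R j y})" by (auto simp: V_def)
    then show ?thesis
      using \<open>finite J\<close> by (auto intro!: open_INT open_Collect_less continuous_intros contR)
  qed
  have smooth_upd: "smooth_on (\<lambda>y. upd (c y) y) S"
    if "open S" and "\<And>j. j \<in> J \<Longrightarrow> smooth_on (\<lambda>y. c y j) S" for c S
    unfolding upd_def
    by (intro smooth_on_add smooth_on_sum smooth_on_scaleR smooth_on_diff that smooth_on_const
        smooth_on_linear bounded_linear_ident bounded_linear_inner_left)
  have smoothR: "smooth_on (R j) S" if "j \<in> J" "open S" for j S
    using smooth_on_subset[OF smooth[OF that(1)] subset_UNIV that(2)] .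
  have "smooth_on f U"
    unfolding f_def
    by (intro smooth_upd smooth_on_add smooth_on_power2 smoothR smooth_on_linear
        bounded_linear_inner_left \<open>open U\<close>)
  moreover have "smooth_on g V"
    unfolding g_def
    by (intro smooth_upd smooth_on_mult smooth_on_sqrt smooth_on_diff smoothR smooth_on_const
        smooth_on_linear bounded_linear_inner_left \<open>open V\<close>) (auto simp: V_def)
  ultimately have "diffeomorphism U V f g"
    unfolding diffeomorphism_def
    by (auto intro!: homeomorphismI smooth_on_imp_continuous_on simp: f_V g_U gf fg)
  moreover have "x \<in> U"
    using nz by (force simp: U_def s_def sgn_if)
  moreover have "subspace L"
    by (auto simp: L_def subspace_def inner_add_left)
  moreover have "dim L = DIM('a) - card J"
  proof -
    have "L = {y. \<forall>i\<in>Basis. i \<notin> Basis - e ` J \<longrightarrow> y \<bullet> i = 0}"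
      using Basis by (auto simp: L_def)
    then have "dim L = card (Basis - e ` J)"
      using dim_substandard[of "Basis - e ` J"] by simp
    also have "\<dots> = DIM('a) - card J"
      using Basis \<open>finite J\<close> inj by (simp add: card_Diff_subset card_image)
    finally show ?thesis .
  qed
  moreover have "f ` (U \<inter> M) = V \<inter> L"
  proof
    show "f ` (U \<inter> M) \<subseteq> V \<inter> L"
      using f_V by (auto simp: M L_def f_def upd_in)
    show "V \<inter> L \<subseteq> f ` (U \<inter> M)"
    proof
      fix y assume y: "y \<in> V \<inter> L"
      \<comment> \<open>The coordinate of \<open>f (g y) = y\<close> along \<open>e j\<close> is the
        value of the equation at \<open>g y\<close>, and it vanishes because \<open>y\<close> lies
        in \<open>L\<close>.\<close>
      have "(g y \<bullet> e j)\<^sup>2 + R j (g y) = 0" if "j \<in> J" for j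
        using fg[of y] upd_in[OF that, of "\<lambda>j. (g y \<bullet> e j)\<^sup>2 + R j (g y)" "g y"] y that
        by (simp add: f_def L_def)
      then show "y \<in> f ` (U \<inter> M)"
        using y fg[of y] g_U[of y] by (force simp: M)
    qed
  qed
  ultimately show ?thesis by blast
qed


section \<open>The moment equations\<close>

text \<open>The \<open>v\<close> with \<open>(v, 1)\<close> in the span form an affine set
  containing \<open>A\<close>, hence everything; adding multiples of \<open>(0, 1)\<close> reaches
  every height.\<close>

lemma span_homogenization:
  fixes A :: "'a::real_vector set"
  assumes "affine hull A = UNIV"
  shows "span ((\<lambda>a. (a, 1::real)) ` A) = UNIV"
proof -
  let ?W = "span ((\<lambda>a. (a, 1::real)) ` A)"
  have "affine {v. (v, 1) \<in> ?W}"
  proof (unfold affine_def, safe)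
    fix v w and a b :: real
    assume "(v, 1) \<in> ?W" "(w, 1) \<in> ?W" and ab: "a + b = 1"
    then have "a *\<^sub>R (v, 1) + b *\<^sub>R (w, 1) \<in> ?W"
      by (intro span_add span_scale)
    then show "(a *\<^sub>R v + b *\<^sub>R w, 1) \<in> ?W"
      using ab by simp
  qed
  then have "affine hull A \<subseteq> {v. (v, 1) \<in> ?W}"
    by (intro hull_minimal) (auto intro: span_base)
  then have 1: "(v, 1) \<in> ?W" for v
    using assms by auto
  have "(v, t) \<in> ?W" for v t
    using span_add[OF 1[of v] span_scale[OF 1[of 0], of "t - 1"]] by simp
  then show ?thesis by auto
qed

text \<open>Caratheodory's theorem places 0 in the hull of at most \<open>aff_dim + 1\<close> of the
  vectors, while weak hyperbolicity demands more than the dimension of the space; so the affine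
  dimension is full.\<close>

lemma affine_hull_support:
  fixes lam :: "'n::finite \<Rightarrow> 'a::euclidean_space"
  assumes "weakly_hyperbolic lam" and "0 \<in> convex hull (lam ` I)"
  shows "affine hull (lam ` I) = UNIV"
proof -
  obtain S where S: "finite S" "S \<subseteq> lam ` I" "int (card S) \<le> aff_dim (lam ` I) + 1"
    "0 \<in> convex hull S"
    using assms(2) unfolding caratheodory_aff_dim[of "lam ` I"] by auto
  \<comment> \<open>One index is chosen per vector of \<open>S\<close>, since weak hyperbolicity
    counts indices.\<close>
  then obtain J where "J \<subseteq> I" "inj_on lam J" "S = lam ` J"
    by (auto simp: subset_image_inj)
  then have "DIM('a) < card S"
    using S assms(1) by (auto simp: weakly_hyperbolic_def card_image)
  then have "int (DIM('a)) \<le> aff_dim (lam ` I)"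
    using S(3) by linarith
  then have "aff_dim (lam ` I) = DIM('a)"
    using aff_dim_le_DIM[of "lam ` I"] by linarith
  then show ?thesis by (simp add: aff_dim_eq_full)
qed

text \<open>The second equation says that \<open>q\<close> lies on the unit sphere, and both
  equations are closed conditions.\<close>

lemma compact_Z_quat:
  fixes lam :: "'n::finite \<Rightarrow> 'a::euclidean_space"
  shows "compact (Z_quat lam)"
proof -
  have "norm q = 1" if "q \<in> Z_quat lam" for q
    using that by (simp add: Z_quat_def norm_vec_def L2_set_def)
  then have "bounded (Z_quat lam)"
    by (intro boundedI[of _ 1]) auto
  moreover have "closed (Z_quat lam)"
    unfolding Z_quat_def
    by (intro closed_Collect_conj closed_Collect_eq continuous_intros)
  ultimately show ?thesis by (simp add: compact_eq_bounded_closed)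
qed

text \<open>A basis taken from the support of \<open>x\<close> brings the system of
  \<open>DIM('a) + 1\<close> real equations to the shape of
  \<open>quadratic_slice_chart\<close>.\<close>

lemma Z_quat_slice_chart:
  fixes lam :: "'n::finite \<Rightarrow> 'a::euclidean_space"
  assumes wh: "weakly_hyperbolic lam" and x: "x \<in> Z_quat lam"
  shows "\<exists>U V f g L. x \<in> U \<and> diffeomorphism U V f g \<and>
    subspace (L :: (quat ^ 'n) set) \<and> dim L = 4 * CARD('n) - (DIM('a) + 1) \<and>
    f ` (U \<inter> Z_quat lam) = V \<inter> L"
proof -
  define I where "I = {i. x $ i \<noteq> 0}"
  define w where "w i = (lam i, 1::real)" for i
  have sum_x: "(\<Sum>i\<in>UNIV. (norm (x $ i))\<^sup>2 *\<^sub>R lam i) = 0" "(\<Sum>i\<in>UNIV. (norm (x $ i))\<^sup>2) = 1"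
    using x by (auto simp: Z_quat_def)
  \<comment> \<open>Terms outside the support vanish, so the squared moduli over \<open>I\<close>
    are convex weights.\<close>
  have "(\<Sum>i\<in>I. (norm (x $ i))\<^sup>2 *\<^sub>R lam i) = 0" "(\<Sum>i\<in>I. (norm (x $ i))\<^sup>2) = 1"
    unfolding sum_x[symmetric] by (auto intro!: sum.mono_neutral_left simp: I_def)
  then have "0 \<in> convex hull (lam ` I)"
    using convex_sum[of I "convex hull (lam ` I)" "\<lambda>i. (norm (x $ i))\<^sup>2" lam]
    by (auto intro: hull_inc)
  then have "span ((\<lambda>a. (a, 1::real)) ` lam ` I) = UNIV"
    by (intro span_homogenization affine_hull_support[OF wh])
  then have span_w: "span (w ` I) = UNIV"
    by (simp add: image_image w_def)
  obtain B where B: "B \<subseteq> w ` I" "independent B" "w ` I \<subseteq> span B"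
    using maximal_independent_subset by blast
  then have span_B: "span B = UNIV"
    using span_w span_minimal[OF B(3) subspace_span] by auto
  \<comment> \<open>The indices of the basis vectors are taken in the support, so
    \<open>x $ j\<close> is nonzero for every \<open>j\<close> in \<open>J\<close>.\<close>
  obtain J where J: "J \<subseteq> I" "inj_on w J" "B = w ` J"
    using B(1) by (auto simp: subset_image_inj)
  have "card J = card B"
    using J by (simp add: card_image)
  also have "\<dots> = DIM('a) + 1"
    using dim_eq_card_independent[OF B(2)] span_B
    by (metis DIM_prod DIM_real dim_UNIV dim_span)
  finally have card_J: "card J = DIM('a) + 1" .

  \<comment> \<open>For \<open>j\<close> in \<open>J\<close> this is the coordinate functional dual
    to the basis vector \<open>w j\<close>.\<close>
  define \<psi> where "\<psi> j v = representation B v (w j)" for j v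
  have "linear (\<psi> j)" for j
    unfolding \<psi>_def
    by (rule linearI) (simp_all add: span_B B(2) representation_add representation_scale)
  note lin = linear_sum[OF this] linear_scale[OF this] linear_diff[OF this]
  have dual: "\<psi> j (w i) = (if i = j then 1 else 0)" if "i \<in> J" "j \<in> J" for i j
    using that J B(2) by (auto simp: \<psi>_def representation_basis inj_on_eq_iff)
  have \<psi>_0: "\<psi> j 0 = 0" for j
    by (simp add: \<psi>_def representation_zero)
  have \<psi>_zero: "v = 0" if "\<And>j. j \<in> J \<Longrightarrow> \<psi> j v = 0" for v
  proof -
    have "(\<Sum>c\<in>B. representation B v c *\<^sub>R c) = v"
      using B(1) by (intro sum_representation_eq[OF B(2)]) (auto simp: span_B finite_subset)
    moreover have "representation B v c = 0" if "c \<in> B" for c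
      using that \<open>\<And>j. j \<in> J \<Longrightarrow> \<psi> j v = 0\<close> J(3) by (auto simp: \<psi>_def)
    ultimately show ?thesis by simp
  qed

  \<comment> \<open>A nonzero quaternion has a nonzero real coordinate; \<open>b j\<close> picks the
    one to be solved for.\<close>
  have "\<exists>b. b \<in> Basis \<and> x $ j \<bullet> b \<noteq> 0" if "j \<in> J" for j
    using that J(1) euclidean_all_zero_iff[of "x $ j"] by (auto simp: I_def)
  then obtain b where b: "\<And>j. j \<in> J \<Longrightarrow> b j \<in> Basis" "\<And>j. j \<in> J \<Longrightarrow> x $ j \<bullet> b j \<noteq> 0"
    by metis
  define e where "e j = (axis j (b j) :: quat ^ 'n)" for j
  have e: "q \<bullet> e j = q $ j \<bullet> b j" for q j
    by (simp add: e_def inner_axis)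
  \<comment> \<open>This is \<open>\<psi> j\<close> applied to both equations packed into one: the
    weighted sum of the \<open>w i\<close> minus \<open>(0, 1)\<close>.\<close>
  define \<Phi> where "\<Phi> j q = (\<Sum>i\<in>UNIV. \<psi> j (w i) * (norm (q $ i))\<^sup>2) - \<psi> j (0, 1)" for j and q :: "quat ^ 'n"
  define R where "R j q = \<Phi> j q - (q \<bullet> e j)\<^sup>2" for j q
  have norm2: "(norm z)\<^sup>2 = (\<Sum>c\<in>Basis. (z \<bullet> c)\<^sup>2)" for z :: quat
    by (simp add: norm_eq_sqrt_inner euclidean_inner[of z z] power2_eq_square sum_nonneg)

  \<comment> \<open>\<open>b j\<close> is nonzero because its inner product with
    \<open>x $ j\<close> is, so \<open>axis j (b j)\<close> determines its index.\<close>
  have "inj_on e J"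
    using b(2) by (force simp: inj_on_def e_def axis_eq_axis)
  have "e ` J \<subseteq> Basis"
    using b by (auto simp: e_def Basis_vec_def)
  have smooth: "smooth_on (R j) UNIV" for j
    unfolding R_def \<Phi>_def power2_norm_eq_inner
    by (intro smooth_on_diff smooth_on_sum smooth_on_mult smooth_on_inner smooth_on_power2
        smooth_on_const smooth_on_linear bounded_linear_inner_left bounded_linear_vec_nth open_UNIV)
  have indep: "R j y = R j z"
    if j: "j \<in> J" and yz: "\<And>c. c \<in> Basis - e ` J \<Longrightarrow> y \<bullet> c = z \<bullet> c" for j y z
  proof -
    have *: "y $ i \<bullet> c = z $ i \<bullet> c" if "c \<in> Basis" "i \<in> J \<Longrightarrow> c \<noteq> b i" for i c
    proof -
      have "axis i c \<in> Basis - e ` J"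
        using that by (auto simp: Basis_vec_def e_def axis_eq_axis)
      from yz[OF this] show ?thesis by (simp add: inner_axis)
    qed
    \<comment> \<open>Duality removes \<open>q $ i\<close> for every other \<open>i\<close> in
      \<open>J\<close> and gives the squared norm of \<open>q $ j\<close> coefficient 1; once the
      square of the selected coordinate is subtracted, only coordinates kept by the chart
      remain.\<close>
    have R': "R j q = (\<Sum>c\<in>Basis - {b j}. (q $ j \<bullet> c)\<^sup>2) +
        (\<Sum>i\<in>-J. \<psi> j (w i) * (norm (q $ i))\<^sup>2) - \<psi> j (0, 1)" for q
    proof -
      have "(\<Sum>i\<in>UNIV. \<psi> j (w i) * (norm (q $ i))\<^sup>2) =
          (\<Sum>i\<in>J. \<psi> j (w i) * (norm (q $ i))\<^sup>2) + (\<Sum>i\<in>-J. \<psi> j (w i) * (norm (q $ i))\<^sup>2)"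
        by (subst sum.union_disjoint[symmetric]) auto
      also have "(\<Sum>i\<in>J. \<psi> j (w i) * (norm (q $ i))\<^sup>2) =
          (\<Sum>i\<in>J. if i = j then (norm (q $ i))\<^sup>2 else 0)"
        using j by (intro sum.cong) (auto simp: dual)
      also have "\<dots> = (norm (q $ j))\<^sup>2"
        using j by simp
      also have "\<dots> = (q $ j \<bullet> b j)\<^sup>2 + (\<Sum>c\<in>Basis - {b j}. (q $ j \<bullet> c)\<^sup>2)"
        unfolding norm2 using b(1)[OF j] by (simp add: sum.remove)
      finally show ?thesis by (simp add: R_def \<Phi>_def e)
    qed
    have "(\<Sum>c\<in>Basis - {b j}. (y $ j \<bullet> c)\<^sup>2) = (\<Sum>c\<in>Basis - {b j}. (z $ j \<bullet> c)\<^sup>2)"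
      by (intro sum.cong) (auto simp: *)
    moreover have "y $ i = z $ i" if "i \<in> -J" for i
      by (rule euclidean_eqI, rule *) (use that in auto)
    ultimately show ?thesis unfolding R' by simp
  qed
  have Z: "Z_quat lam = {q. \<forall>j\<in>J. (q \<bullet> e j)\<^sup>2 + R j q = 0}"
  proof -
    have "q \<in> Z_quat lam \<longleftrightarrow> (\<forall>j\<in>J. \<Phi> j q = 0)" for q
    proof -
      let ?v = "(\<Sum>i\<in>UNIV. (norm (q $ i))\<^sup>2 *\<^sub>R w i) - (0, 1)"
      have "q \<in> Z_quat lam \<longleftrightarrow> ?v = 0"
        by (simp add: Z_quat_def w_def sum_prod prod_eq_iff fst_sum snd_sum)
      \<comment> \<open>The functionals of a basis separate points, so passing to coordinates loses
        no equation.\<close>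
      also have "\<dots> \<longleftrightarrow> (\<forall>j\<in>J. \<psi> j ?v = 0)"
        using \<psi>_zero[of ?v] by (auto simp only: \<psi>_0)
      also have "\<dots> \<longleftrightarrow> (\<forall>j\<in>J. \<Phi> j q = 0)"
        by (simp add: \<Phi>_def lin mult.commute)
      finally show ?thesis .
    qed
    then show ?thesis by (auto simp: R_def)
  qed
  have nz: "x \<bullet> e j \<noteq> 0" if "j \<in> J" for j
    using b(2)[OF that] by (simp add: e)
  have DIM: "DIM(quat ^ 'n) = 4 * CARD('n)" by simp
  show ?thesis
    unfolding card_J[symmetric] DIM[symmetric]
    by (rule quadratic_slice_chart[OF finite \<open>inj_on e J\<close> \<open>e ` J \<subseteq> Basis\<close> smooth _ Z nz])
      (fact indep)
qed

theorem theorem2p2: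
  fixes m :: nat and lam :: "'n::finite \<Rightarrow> real ^ 'p::finite"
  assumes "m \<ge> 1"
    and "CARD('p) = 4 * m"
    and "admissible lam"
    and "affine hull (range lam) = UNIV"
  shows "compact (Z_quat lam) \<and>
         smooth_submanifold (4 * CARD('n) - 4 * m - 1) (Z_quat lam)"
proof
  show "compact (Z_quat lam)" by (rule compact_Z_quat)
  have "weakly_hyperbolic lam"
    using assms(3) by (simp add: admissible_def)
  \<comment> \<open>Admissibility gives \<open>CARD('p) < CARD('n)\<close>, so these truncated
    subtractions agree with those over the integers.\<close>
  moreover have "4 * CARD('n) - (DIM(real ^ 'p) + 1) = 4 * CARD('n) - 4 * m - 1"
    using assms(2) by simp
  ultimately show "smooth_submanifold (4 * CARD('n) - 4 * m - 1) (Z_quat lam)"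
    using Z_quat_slice_chart[of lam] unfolding smooth_submanifold_def by metis
qed

end
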